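(* Let $\mathbb K$ be a field and let $\Phi=(A,A^*;E_i,E^*_i,i=0..d)$ be a Leonard system over $\mathbb K$ which is in $LB$-$UB$ canonical form. Let $p$ be the parameter array of $\Phi$. Then $A=p^L$ and $A^*=p^U$.
   Context: $\mathrm{Mat}_{d+1}(\mathbb K)$ is the algebra of $(d+1)\times(d+1)$ matrices over $\mathbb K$, rows and columns indexed by $0,1,\dots,d$. A matrix is lower bidiagonal if every nonzero entry lies on the diagonal or the subdiagonal, and upper bidiagonal if its transpose is lower bidiagonal. Leonard systems. Let $\mathcal A$ be a $\mathbb K$-algebra isomorphic to $\mathrm{Mat}_{d+1}(\mathbb K)$. An element $A\in\mathcal A$ is multiplicity-free if it has $d+1$ distinct eigenvalues in $\mathbb K$; if these are $\theta_0,\dots,\theta_d$, the primitive idempotent of $A$ associated with $\theta_i$ is $E_i=\prod_{j\ne i}(A-\theta_jI)/(\theta_i-\theta_j)$. For multiplicity-free $A,A^*\in\mathcal A$ ($A^*$ is just a name, not an adjoint), an idempotent sequence for $A,A^*$ is an ordering $E_0,\dots,E_d$ of the primitive idempotents of $A$ such that $E_iA^*E_j=0$ if $|i-j|>1$ and $E_iA^*E_j\ne0$ if $|i-j|=1$ ($0\le i,j\le d$); a dual idempotent sequence for $A,A^*$ is an idempotent sequence for $A^*,A$. A Leonard system in $\mathcal A$ (with ambient algebra $\mathcal A$, over $\mathbb K$) is a sequence $\Phi=(A,A^*;E_i,E^*_i,i=0..d)$ where $A,A^*\in\mathcal A$ are multiplicity-free, $E_0,\dots,E_d$ is an idempotent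 sequence for $A,A^*$ and $E^*_0,\dots,E^*_d$ is a dual idempotent sequence for $A,A^*$. The eigenvalue sequence (resp. dual eigenvalue sequence) of $\Phi$ is $\theta_0,\dots,\theta_d$ (resp. $\theta^*_0,\dots,\theta^*_d$), where $\theta_i$ (resp. $\theta^*_i$) is the eigenvalue of $A$ (resp. $A^*$) associated with $E_i$ (resp. $E^*_i$). Split sequences. Let $V$ be an irreducible left $\mathcal A$-module (unique up to isomorphism, of dimension $d+1$) and set $U_i=(E^*_0V+\cdots+E^*_iV)\cap(E_iV+\cdots+E_dV)$. It is known that each $U_i$ has dimension 1, $V$ is the direct sum of $U_0,\dots,U_d$, $(A-\theta_iI)U_i=U_{i+1}$ ($0\le i\le d-1$), $(A-\theta_dI)U_d=0$, $(A^*-\theta^*_iI)U_i=U_{i-1}$ ($1\le i\le d$), $(A^*-\theta_0^*I)U_0=0$. For $1\le i\le d$, $\varphi_i$ is the (nonzero) eigenvalue of $(A-\theta_{i-1}I)(A^*-\theta^*_iI)$ on $U_i$. The sequence $\varphi_1,\dots,\varphi_d$ is the first split sequence of $\Phi$. The second split sequence $\phi_1,\dots,\phi_d$ of $\Phi$ is the first split sequence of the Leonard system $\Phi^\Downarrow=(A,A^*;E_{d-i},E^*_i,i=0..d)$. The parameter array of $\Phi$ is $p=(\theta_i,\theta^*_i,i=0..d;\varphi_j,\phi_j,j=1..d)$, formed from its eigenvalue sequence, dual eigenvalue sequence, first split sequence and second split sequence. The matrices $p^L,p^U$. For the parameter array $p=(\theta_i,\theta^*_i,i=0..d;\varphi_j,\phi_j,j=1..d)$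 of a Leonard system, $p^L\in\mathrm{Mat}_{d+1}(\mathbb K)$ is the lower bidiagonal matrix with $p^L_{ii}=\theta_i$ ($0\le i\le d$) and $p^L_{i,i-1}=1$ ($1\le i\le d$); $p^U\in\mathrm{Mat}_{d+1}(\mathbb K)$ is the upper bidiagonal matrix with $p^U_{ii}=\theta^*_i$ ($0\le i\le d$) and $p^U_{i-1,i}=\varphi_i$ ($1\le i\le d$). $LB$-$UB$ canonical form. A Leonard system $\Phi=(A,A^*;E_i,E^*_i,i=0..d)$ with eigenvalue sequence $\theta_0,\dots,\theta_d$ and dual eigenvalue sequence $\theta^*_0,\dots,\theta^*_d$ is in $LB$-$UB$ canonical form if (i) its ambient algebra is $\mathrm{Mat}_{d+1}(\mathbb K)$; (ii) $A$ is lower bidiagonal and $A^*$ is upper bidiagonal; (iii) $A_{i,i-1}=1$ for $1\le i\le d$; (iv) $A_{00}=\theta_0$ and $A^*_{00}=\theta^*_0$. *)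

theory Defs
  imports "Jordan_Normal_Form.Char_Poly"
begin

text \<open>
  The ambient algebra is the full matrix algebra of order \<open>Suc d\<close>, i.e.
  \<open>carrier_mat (Suc d) (Suc d)\<close> over a field, and its irreducible module is the
  column space \<open>carrier_vec (Suc d)\<close>. Matrices and vectors are indexed from 0.
  A sequence indexed by \<open>0..d\<close> or \<open>1..d\<close> is a function on \<open>nat\<close> whose other
  values are irrelevant.
\<close>

definition multiplicity_free :: "nat \<Rightarrow> 'a::field mat \<Rightarrow> bool" where
  "multiplicity_free d A \<longleftrightarrow>
     A \<in> carrier_mat (Suc d) (Suc d) \<and> card {t. eigenvalue A t} = Suc d"

text \<open>The factors of the product below commute; they are taken in increasing order of \<open>j\<close>.\<close>

definition idempotent_product :: "nat \<Rightarrow> 'a::field mat \<Rightarrow> (nat \<Rightarrow> 'a) \<Rightarrow> nat \<Rightarrow> 'a mat" where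
  "idempotent_product d A \<theta> i =
     foldr (\<lambda>j M. ((1 / (\<theta> i - \<theta> j)) \<cdot>\<^sub>m (A - \<theta> j \<cdot>\<^sub>m 1\<^sub>m (Suc d))) * M)
       (filter (\<lambda>j. j \<noteq> i) [0..<Suc d]) (1\<^sub>m (Suc d))"

text \<open>\<open>X\<close> is the primitive idempotent of \<open>A\<close> associated with the eigenvalue \<open>t\<close>;
  it does not depend on the enumeration \<open>\<theta>\<close> of the eigenvalues.\<close>

definition primitive_idempotent :: "nat \<Rightarrow> 'a::field mat \<Rightarrow> 'a \<Rightarrow> 'a mat \<Rightarrow> bool" where
  "primitive_idempotent d A t X \<longleftrightarrow>
     (\<exists>\<theta> i. bij_betw \<theta> {0..d} {s. eigenvalue A s} \<and> i \<le> d \<and> \<theta> i = t \<and>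
            X = idempotent_product d A \<theta> i)"

definition idempotent_sequence ::
    "nat \<Rightarrow> 'a::field mat \<Rightarrow> 'a mat \<Rightarrow> (nat \<Rightarrow> 'a mat) \<Rightarrow> bool" where
  "idempotent_sequence d A B E \<longleftrightarrow>
     bij_betw E {0..d} {X. \<exists>t. primitive_idempotent d A t X} \<and>
     (\<forall>i\<le>d. \<forall>j\<le>d.
        (\<bar>int i - int j\<bar> > 1 \<longrightarrow> E i * B * E j = 0\<^sub>m (Suc d) (Suc d)) \<and>
        (\<bar>int i - int j\<bar> = 1 \<longrightarrow> E i * B * E j \<noteq> 0\<^sub>m (Suc d) (Suc d)))"

record 'a leonard =
  opA :: "'a mat"
  opAs :: "'a mat"
  idem :: "nat \<Rightarrow> 'a mat"
  idems :: "nat \<Rightarrow> 'a mat"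

definition leonard_system :: "nat \<Rightarrow> 'a::field leonard \<Rightarrow> bool" where
  "leonard_system d \<Phi> \<longleftrightarrow>
     multiplicity_free d (opA \<Phi>) \<and> multiplicity_free d (opAs \<Phi>) \<and>
     idempotent_sequence d (opA \<Phi>) (opAs \<Phi>) (idem \<Phi>) \<and>
     idempotent_sequence d (opAs \<Phi>) (opA \<Phi>) (idems \<Phi>)"

definition eigenvalue_seq :: "nat \<Rightarrow> 'a::field leonard \<Rightarrow> nat \<Rightarrow> 'a" where
  "eigenvalue_seq d \<Phi> i = (THE t. primitive_idempotent d (opA \<Phi>) t (idem \<Phi> i))"

definition dual_eigenvalue_seq :: "nat \<Rightarrow> 'a::field leonard \<Rightarrow> nat \<Rightarrow> 'a" where
  "dual_eigenvalue_seq d \<Phi> i = (THE t. primitive_idempotent d (opAs \<Phi>) t (idems \<Phi> i))"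

definition image_sum :: "nat \<Rightarrow> (nat \<Rightarrow> 'a::field mat) \<Rightarrow> nat set \<Rightarrow> 'a vec set" where
  "image_sum d E J =
     {finsum_vec TYPE('a) (Suc d) w J | w.
        \<forall>j\<in>J. w j \<in> (\<lambda>v. E j *\<^sub>v v) ` carrier_vec (Suc d)}"

definition split_space :: "nat \<Rightarrow> 'a::field leonard \<Rightarrow> nat \<Rightarrow> 'a vec set" where
  "split_space d \<Phi> i = image_sum d (idems \<Phi>) {0..i} \<inter> image_sum d (idem \<Phi>) {i..d}"

definition first_split_seq :: "nat \<Rightarrow> 'a::field leonard \<Rightarrow> nat \<Rightarrow> 'a" where
  "first_split_seq d \<Phi> i =
     (THE c. \<exists>u \<in> split_space d \<Phi> i.
        eigenvector ((opA \<Phi> - eigenvalue_seq d \<Phi> (i - 1) \<cdot>\<^sub>m 1\<^sub>m (Suc d)) *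
                     (opAs \<Phi> - dual_eigenvalue_seq d \<Phi> i \<cdot>\<^sub>m 1\<^sub>m (Suc d))) u c)"

definition leonard_Down :: "nat \<Rightarrow> 'a leonard \<Rightarrow> 'a leonard" where
  "leonard_Down d \<Phi> = \<Phi>\<lparr>idem := (\<lambda>i. idem \<Phi> (d - i))\<rparr>"

definition second_split_seq :: "nat \<Rightarrow> 'a::field leonard \<Rightarrow> nat \<Rightarrow> 'a" where
  "second_split_seq d \<Phi> = first_split_seq d (leonard_Down d \<Phi>)"

record 'a param_array =
  par_theta :: "nat \<Rightarrow> 'a"
  par_thetas :: "nat \<Rightarrow> 'a"
  par_varphi :: "nat \<Rightarrow> 'a"
  par_phi :: "nat \<Rightarrow> 'a"

definition parameter_array :: "nat \<Rightarrow> 'a::field leonard \<Rightarrow> 'a param_array" where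
  "parameter_array d \<Phi> =
     \<lparr>par_theta = eigenvalue_seq d \<Phi>, par_thetas = dual_eigenvalue_seq d \<Phi>,
      par_varphi = first_split_seq d \<Phi>, par_phi = second_split_seq d \<Phi>\<rparr>"

definition param_L :: "nat \<Rightarrow> 'a::field param_array \<Rightarrow> 'a mat" where
  "param_L d p = mat (Suc d) (Suc d)
     (\<lambda>(i, j). if i = j then par_theta p i else if i = Suc j then 1 else 0)"

definition param_U :: "nat \<Rightarrow> 'a::field param_array \<Rightarrow> 'a mat" where
  "param_U d p = mat (Suc d) (Suc d)
     (\<lambda>(i, j). if i = j then par_thetas p i else if j = Suc i then par_varphi p j else 0)"

definition lower_bidiagonal :: "'a::zero mat \<Rightarrow> bool" where
  "lower_bidiagonal M \<longleftrightarrow>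
     (\<forall>i<dim_row M. \<forall>j<dim_col M. M $$ (i, j) \<noteq> 0 \<longrightarrow> i = j \<or> i = Suc j)"

definition upper_bidiagonal :: "'a::zero mat \<Rightarrow> bool" where
  "upper_bidiagonal M \<longleftrightarrow> lower_bidiagonal (transpose_mat M)"

definition LB_UB_canonical :: "nat \<Rightarrow> 'a::field leonard \<Rightarrow> bool" where
  "LB_UB_canonical d \<Phi> \<longleftrightarrow>
     opA \<Phi> \<in> carrier_mat (Suc d) (Suc d) \<and> opAs \<Phi> \<in> carrier_mat (Suc d) (Suc d) \<and>
     lower_bidiagonal (opA \<Phi>) \<and> upper_bidiagonal (opAs \<Phi>) \<and>
     (\<forall>i\<in>{1..d}. opA \<Phi> $$ (i, i - 1) = 1) \<and>
     opA \<Phi> $$ (0, 0) = eigenvalue_seq d \<Phi> 0 \<and>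
     opAs \<Phi> $$ (0, 0) = dual_eigenvalue_seq d \<Phi> 0"

end

theory Submission
  imports Defs
begin

text \<open>
  Let \<open>P\<close> be an eigenvector matrix of \<open>A\<^sup>*\<close> and \<open>Q\<close> its inverse. The Leonard axioms say that \<open>T = Q A P\<close>
  is irreducible tridiagonal. As \<open>T Q = Q A\<close> with \<open>A\<close> lower bidiagonal, each column of \<open>Q\<close>
  determines the next one up to a scalar, and \<open>A\<^sup>*\<^sub>0\<^sub>0 = \<theta>\<^sup>*\<^sub>0\<close> makes column 0 a multiple of the first
  unit vector; hence \<open>Q\<close> is upper triangular, and \<open>Q A\<^sup>* = diag(\<theta>\<^sup>*) Q\<close> gives
  \<open>A\<^sup>*\<^sub>i\<^sub>i = \<theta>\<^sup>*\<^sub>i\<close>. Transposition exchanges the roles of \<open>A\<close> and \<open>A\<^sup>*\<close>. The two triangular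
  eigenvector matrices show that the split space \<open>U\<^sub>i\<close> is spanned by the \<open>i\<close>-th unit vector, from
  which \<open>\<varphi>\<^sub>i\<close> is read off as the entry of \<open>A\<^sup>*\<close> at \<open>(i - 1, i)\<close>.
\<close>

section \<open>Primitive idempotents acting on eigenvectors\<close>

text \<open>The product in \<open>idempotent_product\<close>, but over an arbitrary index list and
  with \<open>t\<close> in place of \<open>\<theta> i\<close>, so that induction on the list is
  possible.\<close>

definition idempotent_factors :: "nat \<Rightarrow> 'a::field mat \<Rightarrow> 'a \<Rightarrow> (nat \<Rightarrow> 'a) \<Rightarrow> nat list \<Rightarrow> 'a mat" where
  "idempotent_factors d A t \<theta> js =
     foldr (\<lambda>j M. ((1 / (t - \<theta> j)) \<cdot>\<^sub>m (A - \<theta> j \<cdot>\<^sub>m 1\<^sub>m (Suc d))) * M) js (1\<^sub>m (Suc d))"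

lemma idempotent_factors_carrier:
  assumes "A \<in> carrier_mat (Suc d) (Suc d)"
  shows "idempotent_factors d A t \<theta> js \<in> carrier_mat (Suc d) (Suc d)"
  using assms by (induction js) (auto simp: idempotent_factors_def)

lemma smult_mat_mult_vec:
  fixes c :: "'a::comm_ring_1"
  assumes "A \<in> carrier_mat m n" "v \<in> carrier_vec n"
  shows "(c \<cdot>\<^sub>m A) *\<^sub>v v = c \<cdot>\<^sub>v (A *\<^sub>v v)"
  using assms by (intro eq_vecI) (auto simp: scalar_prod_def sum_distrib_left mult.assoc)

text \<open>Each factor acts on an eigenvector as a scalar. The case \<open>t = \<theta> j\<close>
  is covered too, since division by zero gives 0 on both sides.\<close>

lemma idempotent_factors_eigenvector:
  assumes A: "A \<in> carrier_mat (Suc d) (Suc d)" and v: "v \<in> carrier_vec (Suc d)"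
    and eig: "A *\<^sub>v v = s \<cdot>\<^sub>v v"
  shows "idempotent_factors d A t \<theta> js *\<^sub>v v = (\<Prod>j\<leftarrow>js. (s - \<theta> j) / (t - \<theta> j)) \<cdot>\<^sub>v v"
proof (induction js)
  case Nil
  then show ?case using v by (simp add: idempotent_factors_def)
next
  case (Cons j js)
  let ?B = "A - \<theta> j \<cdot>\<^sub>m 1\<^sub>m (Suc d)"
  let ?M = "idempotent_factors d A t \<theta> js"
  let ?p = "\<Prod>j\<leftarrow>js. (s - \<theta> j) / (t - \<theta> j)"
  have B: "?B \<in> carrier_mat (Suc d) (Suc d)" using A by auto
  have Bv: "?B *\<^sub>v v = (s - \<theta> j) \<cdot>\<^sub>v v"
  proof -
    have "?B *\<^sub>v v = A *\<^sub>v v - (\<theta> j \<cdot>\<^sub>m 1\<^sub>m (Suc d)) *\<^sub>v v"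
      using A v by (intro minus_mult_distrib_mat_vec) auto
    also have "\<dots> = s \<cdot>\<^sub>v v - \<theta> j \<cdot>\<^sub>v v"
      using v eig by (simp add: smult_mat_mult_vec[of _ "Suc d" "Suc d"])
    finally show ?thesis using v by (auto simp: algebra_simps)
  qed
  have "idempotent_factors d A t \<theta> (j # js) *\<^sub>v v = (((1 / (t - \<theta> j)) \<cdot>\<^sub>m ?B) * ?M) *\<^sub>v v"
    by (simp add: idempotent_factors_def)
  also have "\<dots> = ((1 / (t - \<theta> j)) \<cdot>\<^sub>m ?B) *\<^sub>v (?M *\<^sub>v v)"
    using B v idempotent_factors_carrier[OF A] by (intro assoc_mult_mat_vec) auto
  also have "\<dots> = ((1 / (t - \<theta> j)) \<cdot>\<^sub>m ?B) *\<^sub>v (?p \<cdot>\<^sub>v v)"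
    by (simp only: Cons.IH)
  also have "\<dots> = ?p \<cdot>\<^sub>v ((1 / (t - \<theta> j)) \<cdot>\<^sub>v (?B *\<^sub>v v))"
    using B v by (simp add: mult_mat_vec[of _ "Suc d" "Suc d"] smult_mat_mult_vec[of _ "Suc d" "Suc d"])
  finally show ?case
    unfolding Bv by (simp add: smult_smult_assoc mult.commute)
qed

lemma primitive_idempotent_carrier:
  assumes "A \<in> carrier_mat (Suc d) (Suc d)" and "primitive_idempotent d A t X"
  shows "X \<in> carrier_mat (Suc d) (Suc d)"
  using assms(2) idempotent_factors_carrier[OF assms(1)]
  unfolding primitive_idempotent_def idempotent_product_def idempotent_factors_def by blast

lemma primitive_idempotent_eigenvalue:
  assumes "primitive_idempotent d A t X"
  shows "eigenvalue A t"
  using assms by (auto simp: primitive_idempotent_def bij_betw_def)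

text \<open>The idempotent is a Lagrange interpolation polynomial evaluated at \<open>A\<close>: at
  \<open>t\<close> every factor is 1, and at any other eigenvalue one factor vanishes.\<close>

lemma primitive_idempotent_eigenvector:
  assumes A: "A \<in> carrier_mat (Suc d) (Suc d)" and X: "primitive_idempotent d A t X"
    and v: "eigenvector A v s"
  shows "X *\<^sub>v v = (if s = t then v else 0\<^sub>v (Suc d))"
proof -
  obtain \<theta> i where \<theta>: "bij_betw \<theta> {0..d} {s. eigenvalue A s}" "i \<le> d" "\<theta> i = t"
    and Xdef: "X = idempotent_product d A \<theta> i"
    using X by (auto simp: primitive_idempotent_def)
  let ?js = "filter (\<lambda>j. j \<noteq> i) [0..<Suc d]"
  have vc: "v \<in> carrier_vec (Suc d)" and Av: "A *\<^sub>v v = s \<cdot>\<^sub>v v"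
    using v A by (auto simp: eigenvector_def)
  have Xv: "X *\<^sub>v v = (\<Prod>j\<leftarrow>?js. (s - \<theta> j) / (\<theta> i - \<theta> j)) \<cdot>\<^sub>v v"
    using idempotent_factors_eigenvector[OF A vc Av, of "\<theta> i" \<theta> ?js]
    by (simp add: Xdef idempotent_product_def idempotent_factors_def)
  show ?thesis
  proof (cases "s = t")
    case True
    have "\<theta> i \<noteq> \<theta> j" if "j \<in> set ?js" for j
    proof -
      from that have "j \<le> d" "j \<noteq> i" by (auto simp del: upt_Suc)
      then show ?thesis using \<theta>(1,2) by (auto simp: bij_betw_def inj_on_def)
    qed
    then have "(\<Prod>j\<leftarrow>?js. (s - \<theta> j) / (\<theta> i - \<theta> j)) = (\<Prod>j\<leftarrow>?js. 1)"
      using True \<theta>(3) by (intro arg_cong[where f = prod_list] map_cong) auto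
    then show ?thesis using True Xv vc by (simp add: map_replicate_const)
  next
    case False
    have "eigenvalue A s" using v by (auto simp: eigenvalue_def)
    then have "s \<in> \<theta> ` {0..d}" using \<theta>(1) by (simp add: bij_betw_def)
    then obtain m where m: "m \<le> d" "\<theta> m = s" by auto
    then have "m \<in> set ?js" using False \<theta>(3) by (auto simp del: upt_Suc)
    then have "(\<Prod>j\<leftarrow>?js. (s - \<theta> j) / (\<theta> i - \<theta> j)) = 0"
      using m(2) by (force simp: prod_list_zero_iff)
    then show ?thesis using False Xv vc by auto
  qed
qed

text \<open>Otherwise an eigenvector for \<open>t\<close> would be both fixed and killed by
  \<open>X\<close>. This gives the uniqueness behind \<open>THE\<close> in the two eigenvalue
  sequences.\<close>

lemma primitive_idempotent_inject:
  assumes A: "A \<in> carrier_mat (Suc d) (Suc d)"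
    and "primitive_idempotent d A t X" "primitive_idempotent d A s X"
  shows "s = t"
proof (rule ccontr)
  assume "s \<noteq> t"
  obtain v where v: "eigenvector A v t"
    using primitive_idempotent_eigenvalue[OF assms(2)] by (auto simp: eigenvalue_def)
  have "v = 0\<^sub>v (Suc d)"
    using primitive_idempotent_eigenvector[OF A assms(2) v]
      primitive_idempotent_eigenvector[OF A assms(3) v] \<open>s \<noteq> t\<close> by simp
  then show False using v A by (auto simp: eigenvector_def)
qed

section \<open>Diagonalisation, and the Leonard conditions on matrix entries\<close>

text \<open>The columns of \<open>P\<close> are eigenvectors and the rows of \<open>Q\<close> form
  the dual basis, so \<open>E k\<close> is the projection onto column \<open>k\<close> along the
  others. The eigenvalue relation is recorded for columns and for rows, so that it survives
  transposition.\<close>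

definition spectral_resolution ::
    "nat \<Rightarrow> 'a::field mat \<Rightarrow> (nat \<Rightarrow> 'a) \<Rightarrow> (nat \<Rightarrow> 'a mat) \<Rightarrow> 'a mat \<Rightarrow> 'a mat \<Rightarrow> bool" where
  "spectral_resolution d A t E P Q \<longleftrightarrow>
     P \<in> carrier_mat (Suc d) (Suc d) \<and> Q \<in> carrier_mat (Suc d) (Suc d) \<and>
     Q * P = 1\<^sub>m (Suc d) \<and> P * Q = 1\<^sub>m (Suc d) \<and> inj_on t {..d} \<and>
     A * P = P * mat_diag (Suc d) t \<and> Q * A = mat_diag (Suc d) t * Q \<and>
     (\<forall>k\<le>d. E k = P * mat_diag (Suc d) (\<lambda>j. if j = k then 1 else 0) * Q)"

text \<open>\<open>t\<close> is spelled out as the \<open>THE\<close> term of the eigenvalue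
  sequences, so that the result fits both halves of a Leonard system.\<close>

lemma spectral_resolution_exists:
  assumes mf: "multiplicity_free d A"
    and E: "bij_betw E {0..d} {X. \<exists>t. primitive_idempotent d A t X}"
  defines "t \<equiv> \<lambda>i. THE t. primitive_idempotent d A t (E i)"
  shows "\<exists>P Q. spectral_resolution d A t E P Q"
proof -
  let ?n = "Suc d"
  note square = assoc_mult_mat[of _ ?n ?n _ ?n _ ?n] mult_carrier_mat[of _ ?n ?n _ ?n]
    right_mult_one_mat[of _ ?n ?n]
  have A: "A \<in> carrier_mat ?n ?n" and card: "card {s. eigenvalue A s} = Suc d"
    using mf by (auto simp: multiplicity_free_def)
  have tE: "primitive_idempotent d A (t k) (E k)" if "k \<le> d" for k
  proof -
    obtain s where "primitive_idempotent d A s (E k)"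
      using bij_betw_apply[OF E, of k] \<open>k \<le> d\<close> by auto
    then show ?thesis unfolding t_def
      by (rule theI) (use A primitive_idempotent_inject \<open>primitive_idempotent d A s (E k)\<close> in blast)
  qed
  have Ec: "E k \<in> carrier_mat ?n ?n" if "k \<le> d" for k
    using primitive_idempotent_carrier[OF A tE[OF that]] .
  have fin: "finite {s. eigenvalue A s}" using card by (metis card.infinite nat.distinct(1))
  \<comment> \<open>Each eigenvalue has a primitive idempotent, which occurs as some
    \<open>E k\<close>; an idempotent has only one eigenvalue, so this one is
    \<open>t k\<close>.\<close>
  have surj: "{s. eigenvalue A s} \<subseteq> t ` {..d}"
  proof
    fix s assume s: "s \<in> {s. eigenvalue A s}"
    obtain \<theta> where \<theta>: "bij_betw \<theta> {0..d} {s. eigenvalue A s}"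
      using fin card ex_bij_betw_nat_finite[OF fin] by (auto simp: atLeastLessThanSuc_atLeastAtMost)
    then have "s \<in> \<theta> ` {0..d}" using s by (simp add: bij_betw_def)
    then obtain i where i: "i \<le> d" "\<theta> i = s" by auto
    then have "primitive_idempotent d A s (idempotent_product d A \<theta> i)"
      using \<theta> by (auto simp: primitive_idempotent_def)
    then have "idempotent_product d A \<theta> i \<in> E ` {0..d}"
      using E by (auto simp: bij_betw_def)
    then obtain k where k: "k \<le> d" "primitive_idempotent d A s (E k)"
      using \<open>primitive_idempotent d A s (idempotent_product d A \<theta> i)\<close> by auto
    then show "s \<in> t ` {..d}"
      using primitive_idempotent_inject[OF A k(2) tE[OF k(1)]] by auto
  qed
  \<comment> \<open>Counting: the \<open>d + 1\<close> indices reach all \<open>d + 1\<close>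
    eigenvalues.\<close>
  have inj: "inj_on t {..d}"
  proof (rule eq_card_imp_inj_on)
    show "card (t ` {..d}) = card {..d}"
      using card_mono[OF _ surj] card card_image_le[of "{..d}" t] by simp
  qed simp
  have "\<exists>v. eigenvector A v (t k)" if "k \<le> d" for k
    using primitive_idempotent_eigenvalue[OF tE[OF that]] by (simp add: eigenvalue_def)
  then obtain v where v: "\<And>k. k \<le> d \<Longrightarrow> eigenvector A (v k) (t k)" by metis
  have vc: "v k \<in> carrier_vec ?n" and Av: "A *\<^sub>v v k = t k \<cdot>\<^sub>v v k" if "k \<le> d" for k
    using v[OF that] A by (auto simp: eigenvector_def)
  have "\<exists>r\<le>d. v k $ r \<noteq> 0" if "k \<le> d" for k
  proof (rule ccontr)
    assume "\<not> ?thesis"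
    then have "v k = 0\<^sub>v ?n" using vc[OF that] by (intro eq_vecI) auto
    then show False using v[OF that] A by (auto simp: eigenvector_def)
  qed
  then obtain r where r: "\<And>k. k \<le> d \<Longrightarrow> r k \<le> d \<and> v k $ r k \<noteq> 0" by metis
  define P where "P = mat ?n ?n (\<lambda>(i, k). v k $ i)"
  define Q where "Q = mat ?n ?n (\<lambda>(k, c). E k $$ (r k, c) / v k $ r k)"
  let ?D = "mat_diag ?n t"
  let ?\<Delta> = "\<lambda>k. mat_diag ?n (\<lambda>j. if j = k then 1 else 0 :: 'a)"
  have Pc: "P \<in> carrier_mat ?n ?n" and Qc: "Q \<in> carrier_mat ?n ?n"
    by (auto simp: P_def Q_def)
  have colP: "col P k = v k" if "k \<le> d" for k
    using that vc[OF that] by (intro eq_vecI) (auto simp: P_def)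
  have Ev: "E k *\<^sub>v v l = (if l = k then v k else 0\<^sub>v ?n)" if "k \<le> d" "l \<le> d" for k l
    using primitive_idempotent_eigenvector[OF A tE[OF that(1)] v[OF that(2)]] inj that
    by (auto simp: inj_on_def)
  \<comment> \<open>\<open>E k\<close> fixes \<open>v k\<close> and kills the other \<open>v l\<close>, so a rescaled nonzero row of each \<open>E k\<close> gives the
    dual basis; no separate proof that the \<open>v k\<close> are independent is needed.\<close>
  have QP: "Q * P = 1\<^sub>m ?n"
  proof (rule eq_matI)
    fix k l assume "k < dim_row (1\<^sub>m ?n)" "l < dim_col (1\<^sub>m ?n)"
    then have kl: "k \<le> d" "l \<le> d" by auto
    have "(Q * P) $$ (k, l) = (\<Sum>c<?n. E k $$ (r k, c) / v k $ r k * v l $ c)"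
      using kl by (simp add: P_def Q_def scalar_prod_def atLeast0LessThan)
    also have "\<dots> = (E k *\<^sub>v v l) $ r k / v k $ r k"
      using kl r[OF kl(1)] Ec[OF kl(1)] vc[OF kl(2)]
      by (auto simp: scalar_prod_def atLeast0LessThan sum_divide_distrib simp del: sum.lessThan_Suc)
    finally show "(Q * P) $$ (k, l) = 1\<^sub>m ?n $$ (k, l)"
      using kl r[OF kl(1)] by (auto simp: Ev)
  qed (use Pc Qc in auto)
  have PQ: "P * Q = 1\<^sub>m ?n" using mat_mult_left_right_inverse[OF Qc Pc QP] .
  have AP: "A * P = P * ?D"
  proof (rule eq_matI)
    fix i k assume "i < dim_row (P * ?D)" "k < dim_col (P * ?D)"
    then have ik: "i \<le> d" "k \<le> d" using Pc by (auto simp: mat_diag_def)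
    have "(A * P) $$ (i, k) = (A *\<^sub>v v k) $ i"
      using ik A Pc by (simp add: colP)
    also have "\<dots> = t k * v k $ i" using ik Av[OF ik(2)] vc[OF ik(2)] by auto
    finally show "(A * P) $$ (i, k) = (P * ?D) $$ (i, k)"
      using ik by (simp add: mat_diag_mult_right[OF Pc]) (simp add: P_def)
  qed (use Pc A in \<open>auto simp: mat_diag_def\<close>)
  have Dc: "?D \<in> carrier_mat ?n ?n" by simp
  have "Q * A = Q * (A * P) * Q"
    using Pc Qc A PQ by (simp add: square)
  also have "\<dots> = (Q * P) * ?D * Q"
    using Pc Qc Dc unfolding AP by (simp add: square)
  finally have QA: "Q * A = ?D * Q" using Dc QP by simp
  have "E k = P * ?\<Delta> k * Q" if k: "k \<le> d" for k
  proof -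
    \<comment> \<open>Column by column: \<open>E k\<close> fixes column \<open>k\<close> of
      \<open>P\<close> and kills the others. Multiplying by \<open>Q\<close> on the right then
      isolates \<open>E k\<close>.\<close>
    have "E k * P = P * ?\<Delta> k"
    proof (rule eq_matI)
      fix i l assume "i < dim_row (P * ?\<Delta> k)" "l < dim_col (P * ?\<Delta> k)"
      then have il: "i \<le> d" "l \<le> d" using Pc by (auto simp: mat_diag_def)
      have "(E k * P) $$ (i, l) = (E k *\<^sub>v v l) $ i"
        using il Ec[OF k] Pc by (simp add: colP)
      then show "(E k * P) $$ (i, l) = (P * ?\<Delta> k) $$ (i, l)"
        using il by (simp add: mat_diag_mult_right[OF Pc] Ev[OF k]) (simp add: P_def)
    qed (use Pc Ec[OF k] in \<open>auto simp: mat_diag_def\<close>)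
    then have "E k * P * Q = P * ?\<Delta> k * Q" by simp
    then show ?thesis using Ec[OF k] Pc Qc PQ by (simp add: square)
  qed
  then have "spectral_resolution d A t E P Q"
    using Pc Qc QP PQ inj AP QA by (auto simp: spectral_resolution_def)
  then show ?thesis by blast
qed

text \<open>Conjugation by \<open>P\<close> turns \<open>E i * B * E j\<close> into
  \<open>Q * B * P\<close> cut down to its entry at \<open>(i, j)\<close>.\<close>

lemma spectral_resolution_sandwich:
  assumes res: "spectral_resolution d A t E P Q" and B: "B \<in> carrier_mat (Suc d) (Suc d)"
    and ij: "i \<le> d" "j \<le> d"
  shows "E i * B * E j = 0\<^sub>m (Suc d) (Suc d) \<longleftrightarrow> (Q * B * P) $$ (i, j) = 0"
proof -
  let ?n = "Suc d"
  note square = assoc_mult_mat[of _ ?n ?n _ ?n _ ?n] mult_carrier_mat[of _ ?n ?n _ ?n]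
    right_mult_one_mat[of _ ?n ?n]
  let ?\<Delta> = "\<lambda>k. mat_diag ?n (\<lambda>j. if j = k then 1 else 0 :: 'a)"
  let ?T = "?\<Delta> i * (Q * B * P) * ?\<Delta> j"
  have c: "P \<in> carrier_mat ?n ?n" "Q \<in> carrier_mat ?n ?n" "?\<Delta> i \<in> carrier_mat ?n ?n"
    "?\<Delta> j \<in> carrier_mat ?n ?n" and inv: "Q * P = 1\<^sub>m ?n"
    and E: "E i = P * ?\<Delta> i * Q" "E j = P * ?\<Delta> j * Q"
    using res ij by (auto simp: spectral_resolution_def)
  have inv': "Q * (P * M) = M" if "M \<in> carrier_mat ?n ?n" for M
    using that c inv by (simp flip: assoc_mult_mat[of _ ?n ?n _ ?n _ ?n])
  have EBE: "E i * B * E j = P * ?T * Q"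
    using c B by (simp add: E square)
  have T: "Q * (E i * B * E j) * P = ?T"
    using c B inv by (simp add: EBE square inv')
  have entry: "?T $$ (k, l) = (if k = i \<and> l = j then (Q * B * P) $$ (i, j) else 0)"
    if "k < ?n" "l < ?n" for k l
  proof -
    have "?\<Delta> i * (Q * B * P) \<in> carrier_mat ?n ?n" "Q * B * P \<in> carrier_mat ?n ?n"
      using c B by (auto simp: square simp del: mat_diag_dim)
    then show ?thesis
      using that by (simp add: mat_diag_mult_right[of _ ?n ?n] mat_diag_mult_left[of _ ?n ?n])
  qed
  show ?thesis
  proof
    assume "E i * B * E j = 0\<^sub>m ?n ?n"
    then have "?T = 0\<^sub>m ?n ?n" using T c by simp
    then show "(Q * B * P) $$ (i, j) = 0" using entry[of i j] ij by simp
  next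
    assume 0: "(Q * B * P) $$ (i, j) = 0"
    have "?T = 0\<^sub>m ?n ?n"
      by (rule eq_matI) (use entry 0 c B in \<open>auto simp: mat_diag_def simp del: index_mult_mat(1)\<close>)
    then show "E i * B * E j = 0\<^sub>m ?n ?n" using EBE c by simp
  qed
qed

lemma mult_mat_entry:
  assumes "A \<in> carrier_mat m n" "B \<in> carrier_mat n l" "i < m" "j < l"
  shows "(A * B) $$ (i, j) = (\<Sum>k<n. A $$ (i, k) * B $$ (k, j))"
  using assms by (auto simp: scalar_prod_def atLeast0LessThan)

section \<open>Triangularity of the eigenvector matrices\<close>

text \<open>Nonzero subdiagonal entries of \<open>A\<close> are an outcome of the induction. Hence
  the lemma serves both the given pair and the transposed one, whose subdiagonal is the still
  unknown superdiagonal of \<open>opAs\<close>.\<close>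

lemma triangular_eigenbasis:
  fixes A B P Q :: "'a::field mat"
  assumes A: "A \<in> carrier_mat (Suc d) (Suc d)" and B: "B \<in> carrier_mat (Suc d) (Suc d)"
    and P: "P \<in> carrier_mat (Suc d) (Suc d)" and Q: "Q \<in> carrier_mat (Suc d) (Suc d)"
    and PQ: "P * Q = 1\<^sub>m (Suc d)" and inj: "inj_on t {..d}"
    and BP: "B * P = P * mat_diag (Suc d) t" and QB: "Q * B = mat_diag (Suc d) t * Q"
    and Abi: "\<And>i j. i \<le> d \<Longrightarrow> j \<le> d \<Longrightarrow> i \<noteq> j \<Longrightarrow> i \<noteq> Suc j \<Longrightarrow> A $$ (i, j) = 0"
    and Btri: "\<And>i j. j < i \<Longrightarrow> i \<le> d \<Longrightarrow> B $$ (i, j) = 0"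
    and T0: "\<And>i j. i \<le> d \<Longrightarrow> Suc j < i \<Longrightarrow> (Q * A * P) $$ (i, j) = 0"
    and T1: "\<And>i. i < d \<Longrightarrow> (Q * A * P) $$ (Suc i, i) \<noteq> 0"
    and B00: "B $$ (0, 0) = t 0"
  shows "\<And>i. i \<le> d \<Longrightarrow> B $$ (i, i) = t i"
    and "\<And>i k. i < k \<Longrightarrow> k \<le> d \<Longrightarrow> Q $$ (k, i) = 0"
    and "\<And>i k. i < k \<Longrightarrow> k \<le> d \<Longrightarrow> P $$ (k, i) = 0"
proof -
  let ?n = "Suc d" and ?T = "Q * A * P"
  note square = assoc_mult_mat[of _ ?n ?n _ ?n _ ?n] mult_carrier_mat[of _ ?n ?n _ ?n]
    right_mult_one_mat[of _ ?n ?n]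
  have T: "?T \<in> carrier_mat ?n ?n" using A P Q by auto
  have TQ: "?T * Q = Q * A" using A P Q PQ by (simp add: square)
  have diagL: "(\<Sum>l<?n. Q $$ (k, l) * B $$ (l, i)) = t k * Q $$ (k, i)" if "k \<le> d" "i \<le> d" for i k
    using that mult_mat_entry[OF Q B, of k i] by (simp add: QB mat_diag_mult_left[OF Q])
  have diagR: "(\<Sum>l<?n. B $$ (k, l) * P $$ (l, i)) = t i * P $$ (k, i)" if "k \<le> d" "i \<le> d" for i k
    using that mult_mat_entry[OF B P, of k i] by (simp add: BP mat_diag_mult_right[OF P] mult.commute)
  \<comment> \<open>Column \<open>i\<close> of \<open>Q\<close> enters the next step through its
    diagonal entry, so the induction must also carry that this entry is nonzero.\<close>
  have tri: "Q $$ (i, i) \<noteq> 0 \<and> (\<forall>k\<le>d. i < k \<longrightarrow> Q $$ (k, i) = 0)" if "i \<le> d" for i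
    using that
  proof (induction i)
    case 0
    \<comment> \<open>Column 0 of \<open>B\<close> is \<open>t 0\<close> times the first unit
      vector, so the row relation \<open>QB\<close> at \<open>(k, 0)\<close> forces the entry to
      vanish, the eigenvalues being distinct.\<close>
    have z: "Q $$ (k, 0) = 0" if k: "0 < k" "k \<le> d" for k
    proof -
      have "(\<Sum>l<?n. Q $$ (k, l) * B $$ (l, 0)) = (\<Sum>l\<in>{0}. Q $$ (k, l) * B $$ (l, 0))"
        by (rule sum.mono_neutral_right) (auto simp: Btri)
      then have "(t k - t 0) * Q $$ (k, 0) = 0"
        using diagL[of k 0] k B00 by (auto simp: algebra_simps simp del: sum.lessThan_Suc)
      moreover have "t k \<noteq> t 0" using inj k by (auto simp: inj_on_def)
      ultimately show ?thesis by simp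
    qed
    have "(\<Sum>k<?n. P $$ (0, k) * Q $$ (k, 0)) = 1"
      using mult_mat_entry[OF P Q, of 0 0] PQ by simp
    moreover have "(\<Sum>k<?n. P $$ (0, k) * Q $$ (k, 0)) = (\<Sum>k\<in>{0}. P $$ (0, k) * Q $$ (k, 0))"
      by (rule sum.mono_neutral_right) (auto simp: z)
    ultimately show ?case using z by auto
  next
    case (Suc i)
    then have IH: "Q $$ (i, i) \<noteq> 0" "\<And>k. k \<le> d \<Longrightarrow> i < k \<Longrightarrow> Q $$ (k, i) = 0" by auto
    \<comment> \<open>Entry \<open>(k, i)\<close> of \<open>?T * Q = Q * A\<close>. On the right,
      bidiagonality leaves columns \<open>i\<close> and \<open>Suc i\<close> of \<open>Q\<close>,
      and the former vanishes in row \<open>k\<close>. On the left, \<open>T0\<close> kills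
      \<open>l < i\<close> and the induction hypothesis kills \<open>l > i\<close>.\<close>
    have step: "Q $$ (k, Suc i) * A $$ (Suc i, i) = ?T $$ (k, i) * Q $$ (i, i)"
      if k: "i < k" "k \<le> d" for k
    proof -
      have "(Q * A) $$ (k, i) = (\<Sum>l<?n. Q $$ (k, l) * A $$ (l, i))"
        using mult_mat_entry[OF Q A] k by simp
      also have "\<dots> = (\<Sum>l\<in>{i, Suc i}. Q $$ (k, l) * A $$ (l, i))"
        using Suc.prems by (intro sum.mono_neutral_right) (auto simp: Abi)
      finally have 1: "(Q * A) $$ (k, i) = Q $$ (k, Suc i) * A $$ (Suc i, i)"
        using IH(2)[of k] k by simp
      have "(?T * Q) $$ (k, i) = (\<Sum>l<?n. ?T $$ (k, l) * Q $$ (l, i))"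
        using mult_mat_entry[OF T Q] k by simp
      also have "\<dots> = (\<Sum>l\<in>{i}. ?T $$ (k, l) * Q $$ (l, i))"
      proof (intro sum.mono_neutral_right ballI)
        fix l assume "l \<in> {..<?n} - {i}"
        then have "Suc l < k \<or> i < l \<and> l \<le> d" using k by auto
        then show "?T $$ (k, l) * Q $$ (l, i) = 0"
          using T0[of k l] IH(2)[of l] k by auto
      qed (use Suc.prems in auto)
      finally show ?thesis using 1 TQ by simp
    qed
    \<comment> \<open>Row \<open>k = Suc i\<close> makes both factors nonzero at once; in the rows
      below, \<open>T0\<close> applies and \<open>A $$ (Suc i, i)\<close> can be cancelled.\<close>
    have "Q $$ (Suc i, Suc i) * A $$ (Suc i, i) \<noteq> 0"
      using step[of "Suc i"] T1[of i] IH(1) Suc.prems by simp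
    moreover from this have "Q $$ (k, Suc i) = 0" if "k \<le> d" "Suc i < k" for k
      using step[of k] T0[of k i] that by simp
    ultimately show ?case by auto
  qed
  show Qtri: "Q $$ (k, i) = 0" if "i < k" "k \<le> d" for i k
    using tri[of i] that by auto
  show diag: "B $$ (i, i) = t i" if i: "i \<le> d" for i
  proof -
    \<comment> \<open>A diagonal entry of a product of upper triangular matrices is the product of
      the diagonal entries; \<open>Q $$ (i, i)\<close> then cancels.\<close>
    have "(\<Sum>l<?n. Q $$ (i, l) * B $$ (l, i)) = (\<Sum>l\<in>{i}. Q $$ (i, l) * B $$ (l, i))"
    proof (intro sum.mono_neutral_right ballI)
      fix l assume "l \<in> {..<?n} - {i}"
      then have "l < i \<or> i < l \<and> l \<le> d" by auto
      then show "Q $$ (i, l) * B $$ (l, i) = 0" using Qtri[of l i] Btri[of i l] i by auto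
    qed (use i in auto)
    then show ?thesis using diagL[OF i i] tri[OF i] by simp
  qed
  show "P $$ (k, i) = 0" if "i < k" "k \<le> d" for i k
    using that
  \<comment> \<open>From the bottom row upwards: triangularity of \<open>B\<close> kills
    \<open>l < k\<close> and the rows already treated kill \<open>l > k\<close>, leaving
    \<open>(t k - t i) * P $$ (k, i) = 0\<close>.\<close>
  proof (induction "d - k" arbitrary: k rule: less_induct)
    case less
    have "(\<Sum>l<?n. B $$ (k, l) * P $$ (l, i)) = (\<Sum>l\<in>{k}. B $$ (k, l) * P $$ (l, i))"
    proof (intro sum.mono_neutral_right ballI)
      fix l assume "l \<in> {..<?n} - {k}"
      then have "l < k \<or> k < l \<and> l \<le> d" by auto
      then show "B $$ (k, l) * P $$ (l, i) = 0"
      proof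
        assume "k < l \<and> l \<le> d"
        then have "P $$ (l, i) = 0" using less.prems by (intro less.hyps) auto
        then show ?thesis by simp
      qed (use Btri less.prems in auto)
    qed (use less.prems in auto)
    then have "(t k - t i) * P $$ (k, i) = 0"
      using diagR[of k i] diag[of k] less.prems by (auto simp: algebra_simps simp del: sum.lessThan_Suc)
    moreover have "t k \<noteq> t i" using inj_onD[OF inj, of k i] less.prems by auto
    ultimately show ?case by simp
  qed
qed

lemma mat_diag_transpose: "transpose_mat (mat_diag n f) = mat_diag n f"
  by (auto simp: mat_diag_def)

section \<open>Sums of eigenspaces in coordinates\<close>

text \<open>\<open>E k\<close> has rank one: it is column \<open>k\<close> of \<open>P\<close> times
  row \<open>k\<close> of \<open>Q\<close>.\<close>

lemma spectral_resolution_mult_vec: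
  assumes res: "spectral_resolution d A t E P Q" and kr: "k \<le> d" "r \<le> d"
    and v: "v \<in> carrier_vec (Suc d)"
  shows "(E k *\<^sub>v v) $ r = P $$ (r, k) * (\<Sum>c<Suc d. Q $$ (k, c) * v $ c)"
proof -
  let ?n = "Suc d"
  have P: "P \<in> carrier_mat ?n ?n" and Q: "Q \<in> carrier_mat ?n ?n"
    and E: "E k = P * mat_diag ?n (\<lambda>j. if j = k then 1 else 0) * Q"
    using res kr by (auto simp: spectral_resolution_def)
  have PD: "P * mat_diag ?n (\<lambda>j. if j = k then 1 else 0) \<in> carrier_mat ?n ?n"
    using P by (auto simp: mat_diag_def)
  have entry: "E k $$ (r, c) = P $$ (r, k) * Q $$ (k, c)" if "c < ?n" for c
  proof -
    have "E k $$ (r, c) = (\<Sum>j<?n. P $$ (r, j) * (if j = k then 1 else 0) * Q $$ (j, c))"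
      using mult_mat_entry[OF PD Q, of r c] kr that
      by (simp add: E mat_diag_mult_right[OF P] del: sum.lessThan_Suc)
    also have "\<dots> = (\<Sum>j<?n. if j = k then P $$ (r, k) * Q $$ (k, c) else 0)"
      by (intro sum.cong) auto
    finally show ?thesis using kr by (simp del: sum.lessThan_Suc)
  qed
  have Ec: "E k \<in> carrier_mat ?n ?n" using PD Q E by auto
  have "(E k *\<^sub>v v) $ r = (\<Sum>c<?n. E k $$ (r, c) * v $ c)"
    using Ec v kr by (auto simp: scalar_prod_def atLeast0LessThan simp del: sum.lessThan_Suc)
  then show ?thesis
    by (simp add: entry sum_distrib_left mult.assoc del: sum.lessThan_Suc)
qed

lemma spectral_resolution_carrier:
  assumes "spectral_resolution d A t E P Q" and "k \<le> d"
  shows "E k \<in> carrier_mat (Suc d) (Suc d)"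
  using assms by (auto simp: spectral_resolution_def mat_diag_def)

lemma image_sum_carrier:
  assumes res: "spectral_resolution d A t E P Q" and J: "J \<subseteq> {..d}"
    and u: "u \<in> image_sum d E J"
  shows "u \<in> carrier_vec (Suc d)"
proof -
  obtain w where w: "u = finsum_vec TYPE('a) (Suc d) w J"
    "\<And>j. j \<in> J \<Longrightarrow> w j \<in> (\<lambda>v. E j *\<^sub>v v) ` carrier_vec (Suc d)"
    using u by (auto simp: image_sum_def)
  have "w j \<in> carrier_vec (Suc d)" if "j \<in> J" for j
    using w(2)[OF that] spectral_resolution_carrier[OF res, of j] that J by auto
  then show ?thesis unfolding w(1) by (intro finsum_vec_closed) auto
qed

text \<open>The image of \<open>E j\<close> consists of multiples of column \<open>j\<close> of
  \<open>P\<close>. This bounds the split spaces from above.\<close>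

lemma image_sum_component_zero:
  assumes res: "spectral_resolution d A t E P Q" and J: "J \<subseteq> {..d}"
    and u: "u \<in> image_sum d E J" and r: "r \<le> d" and P0: "\<And>j. j \<in> J \<Longrightarrow> P $$ (r, j) = 0"
  shows "u $ r = 0"
proof -
  obtain w where w: "u = finsum_vec TYPE('a) (Suc d) w J"
    "\<And>j. j \<in> J \<Longrightarrow> w j \<in> (\<lambda>v. E j *\<^sub>v v) ` carrier_vec (Suc d)"
    using u by (auto simp: image_sum_def)
  have "w j \<in> carrier_vec (Suc d)" if "j \<in> J" for j
    using w(2)[OF that] spectral_resolution_carrier[OF res, of j] that J by auto
  then have "u $ r = (\<Sum>j\<in>J. w j $ r)"
    unfolding w(1) using r J by (intro index_finsum_vec) (auto intro: finite_subset)
  moreover have "w j $ r = 0" if "j \<in> J" for j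
    using w(2)[OF that] spectral_resolution_mult_vec[OF res _ r, of j] that J P0[OF that] by auto
  ultimately show ?thesis by simp
qed

text \<open>By \<open>P * Q = 1\<close>, the unit vector is the sum of all its projections, and
  those with \<open>Q $$ (j, i) = 0\<close> drop out.\<close>

lemma unit_vec_in_image_sum:
  assumes res: "spectral_resolution d A t E P Q" and J: "J \<subseteq> {..d}" and i: "i \<le> d"
    and Q0: "\<And>j. j \<le> d \<Longrightarrow> j \<notin> J \<Longrightarrow> Q $$ (j, i) = 0"
  shows "unit_vec (Suc d) i \<in> image_sum d E J"
proof -
  let ?n = "Suc d"
  let ?e = "unit_vec ?n i :: 'a vec"
  have P: "P \<in> carrier_mat ?n ?n" and Q: "Q \<in> carrier_mat ?n ?n" and PQ: "P * Q = 1\<^sub>m ?n"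
    using res by (auto simp: spectral_resolution_def)
  have Ee: "(E j *\<^sub>v ?e) $ r = P $$ (r, j) * Q $$ (j, i)" if "j \<le> d" "r \<le> d" for j r
  proof -
    have "(\<Sum>c<?n. Q $$ (j, c) * ?e $ c) = (\<Sum>c<?n. if c = i then Q $$ (j, i) else 0)"
      using i by (intro sum.cong) (auto simp: unit_vec_def)
    then show ?thesis
      using spectral_resolution_mult_vec[OF res that, of ?e] i by (simp del: sum.lessThan_Suc)
  qed
  have Ec: "E j *\<^sub>v ?e \<in> carrier_vec ?n" if "j \<in> J" for j
    using spectral_resolution_carrier[OF res, of j] that J by auto
  have fs: "finsum_vec TYPE('a) ?n (\<lambda>j. E j *\<^sub>v ?e) J \<in> carrier_vec ?n"
    by (rule finsum_vec_closed) (use Ec in auto)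
  have "?e = finsum_vec TYPE('a) ?n (\<lambda>j. E j *\<^sub>v ?e) J"
  proof (rule eq_vecI)
    fix r assume "r < dim_vec (finsum_vec TYPE('a) ?n (\<lambda>j. E j *\<^sub>v ?e) J)"
    then have r: "r \<le> d" using fs by auto
    have "finsum_vec TYPE('a) ?n (\<lambda>j. E j *\<^sub>v ?e) J $ r = (\<Sum>j\<in>J. (E j *\<^sub>v ?e) $ r)"
      using r J Ec by (intro index_finsum_vec) (auto intro: finite_subset)
    also have "\<dots> = (\<Sum>j\<in>J. P $$ (r, j) * Q $$ (j, i))"
      by (intro sum.cong refl Ee) (use r J in auto)
    also have "\<dots> = (\<Sum>j<?n. P $$ (r, j) * Q $$ (j, i))"
      using J Q0 by (intro sum.mono_neutral_left) auto
    also have "\<dots> = ?e $ r"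
      using mult_mat_entry[OF P Q, of r i] r i PQ by (auto simp del: sum.lessThan_Suc)
    finally show "?e $ r = finsum_vec TYPE('a) ?n (\<lambda>j. E j *\<^sub>v ?e) J $ r" ..
  qed (use fs in auto)
  then show ?thesis unfolding image_sum_def by (auto intro!: exI[of _ "\<lambda>j. E j *\<^sub>v ?e"])
qed

section \<open>The parameter array read off from the canonical form\<close>

theorem theorem14p3:
  fixes d :: nat and \<Phi> :: "'a::field leonard" and p :: "'a param_array"
  assumes "leonard_system d \<Phi>"
    and "LB_UB_canonical d \<Phi>"
    and "p = parameter_array d \<Phi>"
  shows "opA \<Phi> = param_L d p \<and> opAs \<Phi> = param_U d p"
proof -
  let ?n = "Suc d"
  define A where "A = opA \<Phi>"
  define B where "B = opAs \<Phi>"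
  define t where "t = eigenvalue_seq d \<Phi>"
  define s where "s = dual_eigenvalue_seq d \<Phi>"
  have A: "A \<in> carrier_mat ?n ?n" and B: "B \<in> carrier_mat ?n ?n"
    using assms(2) by (auto simp: LB_UB_canonical_def A_def B_def)
  have lb: "lower_bidiagonal A" "lower_bidiagonal (transpose_mat B)"
    using assms(2) by (simp_all add: LB_UB_canonical_def upper_bidiagonal_def A_def B_def)
  have lbA: "A $$ (i, j) = 0" if "i \<le> d" "j \<le> d" "i \<noteq> j" "i \<noteq> Suc j" for i j
    using that A lb(1) unfolding lower_bidiagonal_def
    by (metis carrier_matD le_imp_less_Suc)
  have lbB: "transpose_mat B $$ (i, j) = 0" if "i \<le> d" "j \<le> d" "i \<noteq> j" "i \<noteq> Suc j" for i j
    using that B lb(2) unfolding lower_bidiagonal_def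
    by (metis carrier_matD le_imp_less_Suc transpose_carrier_mat)
  have ubB: "B $$ (i, j) = 0" if "i \<le> d" "j \<le> d" "i \<noteq> j" "j \<noteq> Suc i" for i j
    using lbB[of j i] that B by auto
  have subA: "A $$ (Suc i, i) = 1" if "i < d" for i
    using assms(2) that by (force simp: LB_UB_canonical_def A_def)
  have A00: "A $$ (0, 0) = t 0" and B00: "B $$ (0, 0) = s 0"
    using assms(2) by (auto simp: LB_UB_canonical_def A_def B_def t_def s_def)
  have mf: "multiplicity_free d A" "multiplicity_free d B"
    and E: "idempotent_sequence d A B (idem \<Phi>)" and Es: "idempotent_sequence d B A (idems \<Phi>)"
    using assms(1) by (auto simp: leonard_system_def A_def B_def)
  have "t = (\<lambda>i. THE x. primitive_idempotent d A x (idem \<Phi> i))"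
    by (simp add: t_def A_def eigenvalue_seq_def fun_eq_iff)
  then obtain P Q where res: "spectral_resolution d A t (idem \<Phi>) P Q"
    using spectral_resolution_exists[OF mf(1), of "idem \<Phi>"] E
    by (auto simp only: idempotent_sequence_def)
  have "s = (\<lambda>i. THE x. primitive_idempotent d B x (idems \<Phi> i))"
    by (simp add: s_def B_def dual_eigenvalue_seq_def fun_eq_iff)
  then obtain Ps Qs where ress: "spectral_resolution d B s (idems \<Phi>) Ps Qs"
    using spectral_resolution_exists[OF mf(2), of "idems \<Phi>"] Es
    by (auto simp only: idempotent_sequence_def)
  note r = res[unfolded spectral_resolution_def] and rs = ress[unfolded spectral_resolution_def]
  have Pc: "P \<in> carrier_mat ?n ?n" and Qc: "Q \<in> carrier_mat ?n ?n" using r by auto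
  have Psc: "Ps \<in> carrier_mat ?n ?n" and Qsc: "Qs \<in> carrier_mat ?n ?n" using rs by auto
  note Ts = spectral_resolution_sandwich[OF ress A]
  note T = spectral_resolution_sandwich[OF res B]
  have Ts0: "(Qs * A * Ps) $$ (i, j) = 0" if "i \<le> d" "Suc j < i" for i j
    using that Es Ts[of i j] by (simp add: idempotent_sequence_def)
  have Ts1: "(Qs * A * Ps) $$ (Suc i, i) \<noteq> 0" if "i < d" for i
    using that Es Ts[of "Suc i" i] by (simp add: idempotent_sequence_def)
  \<comment> \<open>Stated above the diagonal, because this matrix is going to be
    transposed.\<close>
  have T0: "(Q * B * P) $$ (j, i) = 0" if "i \<le> d" "Suc j < i" for i j
    using that E T[of j i] by (simp add: idempotent_sequence_def)
  have T1: "(Q * B * P) $$ (i, Suc i) \<noteq> 0" if "i < d" for i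
    using that E T[of i "Suc i"] by (simp add: idempotent_sequence_def)
  have utB: "B $$ (i, j) = 0" if "j < i" "i \<le> d" for i j
    using that by (intro ubB) auto
  have invs: "Ps * Qs = 1\<^sub>m ?n" "inj_on s {..d}"
    and eigs: "B * Ps = Ps * mat_diag ?n s" "Qs * B = mat_diag ?n s * Qs"
    using rs by auto
  note tris = triangular_eigenbasis[OF A B Psc Qsc invs eigs]
  have diagB: "B $$ (i, i) = s i" if "i \<le> d" for i
    by (rule tris(1)) (fact lbA utB Ts0 Ts1 B00 that)+
  have Qs0: "Qs $$ (k, i) = 0" if "i < k" "k \<le> d" for i k
    by (rule tris(2)) (fact lbA utB Ts0 Ts1 B00 that)+
  have Ps0: "Ps $$ (k, i) = 0" if "i < k" "k \<le> d" for i k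
    by (rule tris(3)) (fact lbA utB Ts0 Ts1 B00 that)+
  \<comment> \<open>Transposed pair: \<open>?B\<close> becomes the lower bidiagonal matrix and
    \<open>?A\<close> the upper triangular one. The eigenvectors of \<open>?A\<close> are the rows
    of \<open>Q\<close>, so \<open>P\<close> and \<open>Q\<close> exchange roles.\<close>
  let ?A = "transpose_mat A" and ?B = "transpose_mat B"
  let ?P = "transpose_mat Q" and ?Q = "transpose_mat P"
  have QBP: "?Q * ?B * ?P = transpose_mat (Q * B * P)"
    using Pc Qc B by (simp add: transpose_mult[of _ ?n ?n _ ?n] assoc_mult_mat[of _ ?n ?n _ ?n _ ?n]
        mult_carrier_mat[of _ ?n ?n _ ?n])
  have mt: "transpose_mat (X * Y) = transpose_mat Y * transpose_mat X"
    if "X \<in> carrier_mat ?n ?n" "Y \<in> carrier_mat ?n ?n" for X Y :: "'a mat"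
    using that by (rule transpose_mult)
  have inv: "?P * ?Q = 1\<^sub>m ?n"
    using mt[OF Pc Qc] r by (metis transpose_one)
  have "?A * ?P = transpose_mat (Q * A)" "?Q * ?A = transpose_mat (A * P)"
    using mt[OF Qc A] mt[OF A Pc] by simp_all
  then have eig: "?A * ?P = ?P * mat_diag ?n t" "?Q * ?A = mat_diag ?n t * ?Q"
    using r mt[OF mat_diag_dim Qc, of t] mt[OF Pc mat_diag_dim, of t]
    by (simp_all add: mat_diag_transpose)
  have TT0: "(?Q * ?B * ?P) $$ (i, j) = 0" if "i \<le> d" "Suc j < i" for i j
    unfolding QBP using T0[OF that] that Pc Qc B by (simp del: index_mult_mat(1))
  have TT1: "(?Q * ?B * ?P) $$ (Suc i, i) \<noteq> 0" if "i < d" for i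
    unfolding QBP using T1[OF that] that Pc Qc B by (simp del: index_mult_mat(1))
  have c: "?A \<in> carrier_mat ?n ?n" "?B \<in> carrier_mat ?n ?n" "?P \<in> carrier_mat ?n ?n"
    "?Q \<in> carrier_mat ?n ?n" using A B Pc Qc by auto
  have ubA: "?A $$ (i, j) = 0" if "j < i" "i \<le> d" for i j
    using that lbA[of j i] A by auto
  have injt: "inj_on t {..d}" using r by auto
  have A00': "?A $$ (0, 0) = t 0" using A A00 by simp
  note tri = triangular_eigenbasis[OF c(2,1,3,4) inv injt eig]
  have "?A $$ (i, i) = t i" if "i \<le> d" for i
    by (rule tri(1)) (fact lbB ubA TT0 TT1 A00' that)+
  then have diagA: "A $$ (i, i) = t i" if "i \<le> d" for i
    using A that by simp
  have "?Q $$ (k, i) = 0" if "i < k" "k \<le> d" for i k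
    by (rule tri(2)) (fact lbB ubA TT0 TT1 A00' that)+
  then have P0: "P $$ (i, k) = 0" if "i < k" "k \<le> d" for i k
    using Pc that by simp
  have "?P $$ (k, i) = 0" if "i < k" "k \<le> d" for i k
    by (rule tri(3)) (fact lbB ubA TT0 TT1 A00' that)+
  then have Q0: "Q $$ (i, k) = 0" if "i < k" "k \<le> d" for i k
    using Qc that by simp
  have split: "first_split_seq d \<Phi> i = B $$ (i - 1, i)" if i: "1 \<le> i" "i \<le> d" for i
  proof -
    let ?e = "unit_vec ?n i :: 'a vec"
    let ?A1 = "A - t (i - 1) \<cdot>\<^sub>m 1\<^sub>m ?n" and ?B1 = "B - s i \<cdot>\<^sub>m 1\<^sub>m ?n"
    let ?M = "?A1 * ?B1"
    have M: "?M \<in> carrier_mat ?n ?n" "?A1 \<in> carrier_mat ?n ?n" "?B1 \<in> carrier_mat ?n ?n"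
      using A B by auto
    \<comment> \<open>\<open>?B1\<close> sends unit vector \<open>i\<close> to
      \<open>B $$ (i - 1, i)\<close> times unit vector \<open>i - 1\<close>, and \<open>?A1\<close>
      sends that one to unit vector \<open>i\<close>: the shifts cancel the diagonal entries, and
      the subdiagonal of \<open>A\<close> is 1.\<close>
    have Me: "?M *\<^sub>v ?e = B $$ (i - 1, i) \<cdot>\<^sub>v ?e"
    proof (rule eq_vecI)
      fix r assume "r < dim_vec (B $$ (i - 1, i) \<cdot>\<^sub>v ?e)"
      then have r: "r \<le> d" by auto
      have "(N *\<^sub>v ?e) $ r = N $$ (r, i)" if "N \<in> carrier_mat ?n ?n" for N
        using that r i by simp
      then have "(?M *\<^sub>v ?e) $ r = ?M $$ (r, i)" using M(1) .
      also have "\<dots> = (\<Sum>k<?n. ?A1 $$ (r, k) * ?B1 $$ (k, i))"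
        using mult_mat_entry[OF M(2,3), of r i] r i by simp
      also have "\<dots> = (\<Sum>k<?n. if k = i - 1 then ?A1 $$ (r, i - 1) * B $$ (i - 1, i) else 0)"
        using i A B diagB[of i] ubB[of _ i] by (intro sum.cong) auto
      also have "\<dots> = ?A1 $$ (r, i - 1) * B $$ (i - 1, i)"
        using i by (simp del: sum.lessThan_Suc)
      also have "?A1 $$ (r, i - 1) = (if r = i then 1 else 0)"
        using i r A diagA[of "i - 1"] lbA[of r "i - 1"] subA[of "i - 1"] by auto
      finally show "(?M *\<^sub>v ?e) $ r = (B $$ (i - 1, i) \<cdot>\<^sub>v ?e) $ r"
        using r i by auto
    qed (use M in auto)
    \<comment> \<open>\<open>Qs\<close> is upper and \<open>Q\<close> lower triangular, so the
      projections outside \<open>{0..i}\<close> and \<open>{i..d}\<close>, respectively,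
      vanish.\<close>
    have e: "?e \<in> split_space d \<Phi> i"
      unfolding split_space_def
      using unit_vec_in_image_sum[OF ress, of "{0..i}" i] unit_vec_in_image_sum[OF res, of "{i..d}" i]
        Qs0 Q0 i by auto
    have u: "u = u $ i \<cdot>\<^sub>v ?e" "u \<in> carrier_vec ?n" if "u \<in> split_space d \<Phi> i" for u
    proof -
      have us: "u \<in> image_sum d (idems \<Phi>) {0..i}" "u \<in> image_sum d (idem \<Phi>) {i..d}"
        using that by (auto simp: split_space_def)
      show uc: "u \<in> carrier_vec ?n" by (rule image_sum_carrier[OF res _ us(2)]) auto
      \<comment> \<open>Components before \<open>i\<close> vanish because \<open>P\<close> is lower
        triangular, those after \<open>i\<close> because \<open>Ps\<close> is upper
        triangular.\<close>
      have "u $ r = 0" if "r \<le> d" "r \<noteq> i" for r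
      proof (cases "r < i")
        case True
        then show ?thesis using image_sum_component_zero[OF res _ us(2), of r] P0 that by auto
      next
        case False
        then show ?thesis using image_sum_component_zero[OF ress _ us(1), of r] Ps0 that i by auto
      qed
      then show "u = u $ i \<cdot>\<^sub>v ?e" using uc i by (intro eq_vecI) auto
    qed
    have "first_split_seq d \<Phi> i = (THE c. \<exists>u \<in> split_space d \<Phi> i. eigenvector ?M u c)"
      unfolding first_split_seq_def by (simp add: A_def B_def t_def s_def)
    also have "\<dots> = B $$ (i - 1, i)"
    proof (rule the_equality)
      have "?e $ i \<noteq> 0\<^sub>v ?n $ i" using i by simp
      then have "?e \<noteq> 0\<^sub>v ?n" by metis
      then have "eigenvector ?M ?e (B $$ (i - 1, i))"
        using Me M by (auto simp: eigenvector_def)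
      then show "\<exists>u \<in> split_space d \<Phi> i. eigenvector ?M u (B $$ (i - 1, i))" using e by blast
    next
      fix c assume "\<exists>u \<in> split_space d \<Phi> i. eigenvector ?M u c"
      then obtain x where x: "x \<in> split_space d \<Phi> i" "eigenvector ?M x c" by blast
      \<comment> \<open>An eigenvector in the split space is thus a nonzero multiple of
        \<open>?e\<close>, and comparing component \<open>i\<close> fixes its eigenvalue.\<close>
      have xi: "x $ i \<noteq> 0"
      proof
        assume "x $ i = 0"
        then have "x = 0\<^sub>v ?n" using u(1)[OF x(1)] by (auto simp: smult_vec_def zero_vec_def)
        then show False using x(2) M by (auto simp: eigenvector_def)
      qed
      have "?M *\<^sub>v x = ?M *\<^sub>v (x $ i \<cdot>\<^sub>v ?e)" using u(1)[OF x(1)] by simp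
      also have "\<dots> = x $ i \<cdot>\<^sub>v (B $$ (i - 1, i) \<cdot>\<^sub>v ?e)"
        using M(1) Me by (simp add: mult_mat_vec[of _ ?n ?n])
      finally have "c \<cdot>\<^sub>v x = x $ i \<cdot>\<^sub>v (B $$ (i - 1, i) \<cdot>\<^sub>v ?e)"
        using x(2) by (simp add: eigenvector_def)
      then have "(c \<cdot>\<^sub>v x) $ i = (x $ i \<cdot>\<^sub>v (B $$ (i - 1, i) \<cdot>\<^sub>v ?e)) $ i" by simp
      then show "c = B $$ (i - 1, i)" using u(2)[OF x(1)] i xi by simp
    qed
    finally show ?thesis .
  qed
  have "A = param_L d p"
    by (rule eq_matI)
      (use A lbA diagA subA in \<open>auto simp: param_L_def assms(3) parameter_array_def t_def\<close>)
  moreover have "B = param_U d p"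
    by (rule eq_matI)
      (use B ubB diagB split in \<open>auto simp: param_U_def assms(3) parameter_array_def s_def\<close>)
  ultimately show ?thesis by (simp add: A_def B_def)
qed

end
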